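(* Let $k\subset\mathbb{P}_2$ be a projective circle, let $c\in\mathbb{P}_2$ be its center, and let $\mathcal{K}=\{c\}$ (the one-letter word $c$). Then every straightedge classical (not necessarily terminating) $\mathrm{EC}_{\mathrm{pr}}(\mathcal{D}_{\mathrm{pr}})$ $T=(r,V,E)$ with root $r=k$ (the one-letter word $k$) has a branch $B$ such that for every vertex $u\in B$ the projective point $c$ is not a letter of $u$. So no straightedge classical $\mathrm{EC}_{\mathrm{pr}}(\mathcal{D}_{\mathrm{pr}})$ constructs $\mathcal{K}$ (the center $c$ of $k$) from $r$ (the given projective circle $k$).
   Context: Let $\mathbb{S}=\{(x,y,z)\in\mathbb{R}^3\;|\;x^2+y^2+z^2=1\}$ and let $\langle\cdot,\cdot\rangle$ be the standard scalar product on $\mathbb{R}^3$. The real projective plane is $\mathbb{P}_2=\{\{\overline{x},-\overline{x}\}\;|\;\overline{x}\in\mathbb{S}\}$; its elements are projective points. A projective line is a set $\{\{\overline{x},-\overline{x}\}\in\mathbb{P}_2\;|\;\langle\overline{x},\overline{y}\rangle=0\}$ with $\overline{y}\in\mathbb{S}$. A projective circle is a set $\{\{\overline{x},-\overline{x}\}\in\mathbb{P}_2\;|\;\langle\overline{x},\overline{y}\rangle=\pm a\}$ with $\overline{y}\in\mathbb{S}$ and $a\in(0,1)$; its center is the projective point $\{\overline{y},-\overline{y}\}$. A projective disc is a set $\{\{\overline{x},-\overline{x}\}\in\mathbb{P}_2\;|\;\langle\overline{x},\overline{y}\rangle>a\text{ or }-\langle\overline{x},\overline{y}\rangle>a\}$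 with $\overline{y}\in\mathbb{S}$, $a\in(0,1)$. Let $\mathcal{P}_{\mathrm{pr}},\mathcal{L}_{\mathrm{pr}},\mathcal{C}_{\mathrm{pr}},\mathcal{D}_{\mathrm{pr}}$ be the sets of all projective points, lines, circles and discs, respectively. Every two distinct projective points lie on a unique projective line. For a set (alphabet) $A$, $A^*$ is the set of finite words over $A$. A rooted tree $T=(r,V,E)$ consists of a vertex set $V$, a root $r\in V$ and edges $E\subset V\times V$ such that for every $u\in V$ there is a unique walk from $r$ to $u$; if $(u,v)\in E$ then $v$ is a child of $u$; a leaf is a vertex with no child; a branch is a maximal (finite or infinite) walk; it starts at $r$ and either ends in a leaf or is infinite. A straightedge classical projective Euclidean construction, i.e. a straightedge classical $\mathrm{EC}_{\mathrm{pr}}(\mathcal{D}_{\mathrm{pr}})$, is a rooted tree $T=(r,V,E)$ with $V\subset(\mathcal{P}_{\mathrm{pr}}\cup\mathcal{L}_{\mathrm{pr}}\cup\mathcal{C}_{\mathrm{pr}}\cup\mathcal{D}_{\mathrm{pr}})^*$ and $r\in(\mathcal{P}_{\mathrm{pr}}\cup\mathcal{L}_{\mathrm{pr}}\cup\mathcal{C}_{\mathrm{pr}})^*$ in which the children of each vertex $u=a_1a_2\dots a_m$, $m\ge0$, are determined by exactly one of the following rules; in rules 1–5 it is assumed that $m=0$ or $a_m\notin\mathcal{D}_{\mathrm{pr}}$. 1. $u$ is a leaf. 2. $u$ has exactly one child $a_1\dots a_ma_{m+1}$, where $a_{m+1}$ is the projective line determined by two distinct projective points that are letters of $u$. 3.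 $u$ has exactly one child $a_1\dots a_ma_{m+1}$, where $a_{m+1}$ is a projective point that is already a letter of $u$ (repetition of a point; drawing new projective circles with compass is forbidden in straightedge constructions). 4. $u$ has exactly one child $a_1\dots a_ma_{m+1}$, where $a_{m+1}$ is a projective point in the intersection of two distinct projective lines, or of two distinct projective circles, or of a projective line and a projective circle, that are letters of $u$. 5. $u$ has exactly one child $a_1\dots a_ma_{m+1}$, where $a_{m+1}\in\mathcal{D}_{\mathrm{pr}}$. 6. $m\ge1$, $a_m\in\mathcal{D}_{\mathrm{pr}}$ and the children of $u$ are exactly the words $a_1\dots a_ma_{m+1}$, one for each projective point $a_{m+1}\in a_m$. $T$ is terminating if all its branches are finite. A construction of this kind constructs $\mathcal{K}\subset(\mathcal{P}_{\mathrm{pr}}\cup\mathcal{L}_{\mathrm{pr}}\cup\mathcal{C}_{\mathrm{pr}})^*$ from $r$ if there is a terminating such $T=(r,V,E)$ with root $r$ such that every leaf $a_1\dots a_m$ of $T$ has a final segment $a_ja_{j+1}\dots a_m\in\mathcal{K}$. *)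

theory Defs
  imports "HOL-Analysis.Analysis" "HOL-Library.Sublist"
begin

type_synonym ppoint = "(real^3) set"

definition ppt :: "real^3 \<Rightarrow> ppoint" where
  "ppt x = {x, - x}"

definition ppoints :: "ppoint set" where
  "ppoints = {ppt x | x. x \<in> sphere 0 1}"

definition pline :: "real^3 \<Rightarrow> ppoint set" where
  "pline y = {ppt x | x. x \<in> sphere 0 1 \<and> x \<bullet> y = 0}"

definition pcircle :: "real^3 \<Rightarrow> real \<Rightarrow> ppoint set" where
  "pcircle y a = {ppt x | x. x \<in> sphere 0 1 \<and> (x \<bullet> y = a \<or> x \<bullet> y = - a)}"

definition pdisc :: "real^3 \<Rightarrow> real \<Rightarrow> ppoint set" where
  "pdisc y a = {ppt x | x. x \<in> sphere 0 1 \<and> (x \<bullet> y > a \<or> - (x \<bullet> y) > a)}"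

definition plines :: "ppoint set set" where
  "plines = {pline y | y. y \<in> sphere 0 1}"

definition pcircles :: "ppoint set set" where
  "pcircles = {pcircle y a | y a. y \<in> sphere 0 1 \<and> a \<in> {0<..<1}}"

definition pdiscs :: "ppoint set set" where
  "pdiscs = {pdisc y a | y a. y \<in> sphere 0 1 \<and> a \<in> {0<..<1}}"

definition is_pcenter :: "ppoint \<Rightarrow> ppoint set \<Rightarrow> bool" where
  "is_pcenter c k \<longleftrightarrow>
     (\<exists>y a. y \<in> sphere 0 1 \<and> a \<in> {0<..<1} \<and> k = pcircle y a \<and> c = ppt y)"

text \<open>A walk in a directed graph is recorded by its sequence of vertices; a finite walk has
  at least one vertex.\<close>

datatype 'v walk = Finite_walk "'v list" | Infinite_walk "nat \<Rightarrow> 'v"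

fun walk_verts :: "'v walk \<Rightarrow> 'v set" where
  "walk_verts (Finite_walk xs) = set xs"
| "walk_verts (Infinite_walk f) = range f"

fun is_walk :: "'v set \<Rightarrow> ('v \<times> 'v) set \<Rightarrow> 'v walk \<Rightarrow> bool" where
  "is_walk V E (Finite_walk xs) \<longleftrightarrow>
     xs \<noteq> [] \<and> set xs \<subseteq> V \<and> successively (\<lambda>u v. (u, v) \<in> E) xs"
| "is_walk V E (Infinite_walk f) \<longleftrightarrow>
     range f \<subseteq> V \<and> (\<forall>i. (f i, f (Suc i)) \<in> E)"

fun walk_segment :: "'v walk \<Rightarrow> 'v walk \<Rightarrow> bool" where
  "walk_segment (Finite_walk xs) (Finite_walk ys) \<longleftrightarrow> sublist xs ys"
| "walk_segment (Finite_walk xs) (Infinite_walk g) \<longleftrightarrow>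
     (\<exists>n. \<forall>i<length xs. xs ! i = g (n + i))"
| "walk_segment (Infinite_walk f) (Finite_walk ys) \<longleftrightarrow> False"
| "walk_segment (Infinite_walk f) (Infinite_walk g) \<longleftrightarrow> (\<exists>n. \<forall>i. f i = g (n + i))"

definition rooted_tree :: "'v \<Rightarrow> 'v set \<Rightarrow> ('v \<times> 'v) set \<Rightarrow> bool" where
  "rooted_tree r V E \<longleftrightarrow>
     r \<in> V \<and> E \<subseteq> V \<times> V \<and>
     (\<forall>u\<in>V. \<exists>!xs. is_walk V E (Finite_walk xs) \<and> hd xs = r \<and> last xs = u)"

definition children :: "('v \<times> 'v) set \<Rightarrow> 'v \<Rightarrow> 'v set" where
  "children E u = {v. (u, v) \<in> E}"

text \<open>Maximality refers to extension at either end; in a rooted tree a maximal walk therefore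
  starts at the root and is infinite or ends in a leaf.\<close>

definition is_branch :: "'v set \<Rightarrow> ('v \<times> 'v) set \<Rightarrow> 'v walk \<Rightarrow> bool" where
  "is_branch V E B \<longleftrightarrow>
     is_walk V E B \<and> (\<forall>B'. is_walk V E B' \<and> walk_segment B B' \<longrightarrow> B' = B)"

definition terminating :: "'v set \<Rightarrow> ('v \<times> 'v) set \<Rightarrow> bool" where
  "terminating V E \<longleftrightarrow> (\<forall>B. is_branch V E B \<longrightarrow> (\<exists>xs. B = Finite_walk xs))"

text \<open>The alphabet mixes points and sets of points. Lines, circles and discs have the same type
  and are not tagged further: they are pairwise different as sets of points.\<close>

datatype letter = Pt ppoint | Fig "ppoint set"

definition letters_PLC :: "letter set" where
  "letters_PLC = Pt ` ppoints \<union> Fig ` plines \<union> Fig ` pcircles"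

definition letters_PLCD :: "letter set" where
  "letters_PLCD = letters_PLC \<union> Fig ` pdiscs"

definition joining_line :: "letter list \<Rightarrow> ppoint set \<Rightarrow> bool" where
  "joining_line u l \<longleftrightarrow>
     l \<in> plines \<and>
     (\<exists>p q. p \<in> ppoints \<and> q \<in> ppoints \<and> p \<noteq> q \<and> Pt p \<in> set u \<and> Pt q \<in> set u \<and>
        p \<in> l \<and> q \<in> l)"

definition intersection_point :: "letter list \<Rightarrow> ppoint \<Rightarrow> bool" where
  "intersection_point u p \<longleftrightarrow>
     (\<exists>s t. Fig s \<in> set u \<and> Fig t \<in> set u \<and> p \<in> s \<inter> t \<and>
        (s \<in> plines \<and> t \<in> plines \<and> s \<noteq> t \<or>
         s \<in> pcircles \<and> t \<in> pcircles \<and> s \<noteq> t \<or>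
         s \<in> plines \<and> t \<in> pcircles))"

definition ends_in_disc :: "letter list \<Rightarrow> bool" where
  "ends_in_disc u \<longleftrightarrow> u \<noteq> [] \<and> last u \<in> Fig ` pdiscs"

text \<open>One disjunct per rule. The disjunction is inclusive: a point may be both a repetition and
  an intersection point, which does not make the step illegal.\<close>

definition straightedge_step :: "letter list \<Rightarrow> letter list set \<Rightarrow> bool" where
  "straightedge_step u C \<longleftrightarrow>
     \<not> ends_in_disc u \<and>
       (C = {} \<or>
        (\<exists>l. joining_line u l \<and> C = {u @ [Fig l]}) \<or>
        (\<exists>p\<in>ppoints. Pt p \<in> set u \<and> C = {u @ [Pt p]}) \<or>
        (\<exists>p\<in>ppoints. intersection_point u p \<and> C = {u @ [Pt p]}) \<or>
        (\<exists>d\<in>pdiscs. C = {u @ [Fig d]})) \<or>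
     u \<noteq> [] \<and> (\<exists>d\<in>pdiscs. last u = Fig d \<and> C = {u @ [Pt p] | p. p \<in> ppoints \<and> p \<in> d})"

definition straightedge_EC ::
  "letter list \<Rightarrow> letter list set \<Rightarrow> (letter list \<times> letter list) set \<Rightarrow> bool" where
  "straightedge_EC r V E \<longleftrightarrow>
     rooted_tree r V E \<and> V \<subseteq> lists letters_PLCD \<and> r \<in> lists letters_PLC \<and>
     (\<forall>u\<in>V. straightedge_step u (children E u))"

definition straightedge_constructs :: "letter list set \<Rightarrow> letter list \<Rightarrow> bool" where
  "straightedge_constructs K r \<longleftrightarrow>
     (\<exists>V E. straightedge_EC r V E \<and> terminating V E \<and>
        (\<forall>u\<in>V. children E u = {} \<longrightarrow> (\<exists>w\<in>K. suffix w u)))"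

end

theory Submission
  imports Defs
begin

text \<open>
  Closing a countable dense set of points under drawing joining lines and intersecting them with
  each other and with the only circle \<open>k\<close> yields a countable set \<open>G\<close>. The projective
  transformations that preserve \<open>k\<close> move its center to uncountably many positions, so one of them
  takes the center outside \<open>G\<close>. The preimage of \<open>G\<close> under it is still dense and closed under all
  straightedge steps, but does not contain the center. Whenever a point of a disc has to be chosen,
  choose it from this preimage: along the resulting branch the center never occurs.
\<close>

subsection \<open>Incidence of points, lines, circles and discs\<close>

lemma ppt_uminus: "ppt (- x) = ppt x"
  by (auto simp: ppt_def)

lemma ppt_eq_iff: "ppt x = ppt x' \<longleftrightarrow> x = x' \<or> x = - x'"
  by (auto simp: ppt_def doubleton_eq_iff)

lemma ppt_in_ppoints_iff: "ppt x \<in> ppoints \<longleftrightarrow> norm x = 1"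
  by (auto simp: ppoints_def ppt_eq_iff)

lemma ppt_in_pline_iff: "ppt x \<in> pline y \<longleftrightarrow> norm x = 1 \<and> x \<bullet> y = 0"
  by (auto simp: pline_def ppt_eq_iff)

lemma ppt_in_pcircle_iff:
  "ppt x \<in> pcircle y a \<longleftrightarrow> norm x = 1 \<and> (x \<bullet> y = a \<or> x \<bullet> y = - a)"
  by (fastforce simp: pcircle_def ppt_eq_iff)

lemma ppt_in_pdisc_iff:
  "ppt x \<in> pdisc y a \<longleftrightarrow> norm x = 1 \<and> (x \<bullet> y > a \<or> - (x \<bullet> y) > a)"
  by (fastforce simp: pdisc_def ppt_eq_iff)

lemma ppointsE:
  assumes "p \<in> ppoints"
  obtains x where "p = ppt x" "norm x = 1"
  using assms by (auto simp: ppoints_def)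

lemma pline_subset: "pline y \<subseteq> ppoints"
  and pcircle_subset: "pcircle y a \<subseteq> ppoints"
  and pdisc_subset: "pdisc y a \<subseteq> ppoints"
  by (auto simp: pline_def pcircle_def pdisc_def ppoints_def)

lemma plines_subset: "l \<in> plines \<Longrightarrow> l \<subseteq> ppoints"
  using pline_subset by (auto simp: plines_def)

text \<open>Two vectors span at most a plane, so three-dimensional space leaves a direction
  orthogonal to both. Geometrically, any two projective lines meet.\<close>

lemma unit_vector_orthogonal_both:
  fixes y z :: "real^3"
  obtains x where "norm x = 1" "x \<bullet> y = 0" "x \<bullet> z = 0"
proof -
  have "dim {y, z} < DIM(real^3)"
    using dim_le_card'[of "{y, z}"] card_insert_le_m1[of 2 "{z}" y] by simp
  then obtain x where x: "x \<noteq> 0" "\<And>v. v \<in> span {y, z} \<Longrightarrow> orthogonal x v"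
    using orthogonal_to_subspace_exists by blast
  show ?thesis
    by (rule that[of "sgn x"]) (use x in \<open>auto simp: norm_sgn sgn_div_norm orthogonal_def span_base\<close>)
qed

text \<open>Figures carry no tag, so their kinds must be told apart as sets. Every line meets the
  polar line of \<open>z\<close>, and no circle around \<open>z\<close> does, since its radius
  parameter is positive. The same point separates lines from discs.\<close>

lemma plines_pcircles_disjoint: "plines \<inter> pcircles = {}"
proof -
  have False if "0 < a" "pline y = pcircle z a" for y z a
  proof -
    obtain x where "norm x = 1" "x \<bullet> y = 0" "x \<bullet> z = 0"
      by (rule unit_vector_orthogonal_both)
    then have "ppt x \<in> pline y" "ppt x \<notin> pcircle z a"
      using that(1) by (auto simp: ppt_in_pline_iff ppt_in_pcircle_iff)
    then show False using that(2) by simp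
  qed
  then show ?thesis by (auto simp: plines_def pcircles_def)
qed

lemma plines_pdiscs_disjoint: "plines \<inter> pdiscs = {}"
proof -
  have False if "0 < a" "pline y = pdisc z a" for y z a
  proof -
    obtain x where "norm x = 1" "x \<bullet> y = 0" "x \<bullet> z = 0"
      by (rule unit_vector_orthogonal_both)
    then have "ppt x \<in> pline y" "ppt x \<notin> pdisc z a"
      using that(1) by (auto simp: ppt_in_pline_iff ppt_in_pdisc_iff)
    then show False using that(2) by simp
  qed
  then show ?thesis by (auto simp: plines_def pdiscs_def)
qed

text \<open>The homogeneous inequality describes the open cone over a disc, which allows work with
  unnormalised vectors.\<close>

lemma ppt_sgn_in_pdisc:
  assumes "x \<noteq> 0" "x \<bullet> y > a * norm x"
  shows "ppt (sgn x) \<in> pdisc y a"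
  using assms by (auto simp: ppt_in_pdisc_iff norm_sgn sgn_div_norm field_simps)

text \<open>The cone over a disc is open, whereas the cone over a circle is the zero set of a
  nontrivial quadratic form and cannot contain a ball.\<close>

lemma pcircles_pdiscs_disjoint: "pcircles \<inter> pdiscs = {}"
proof -
  have False if a: "0 < a" "a < 1" and b: "0 < b" "b < 1"
    and y: "norm y = 1" and z: "norm z = 1" and eq: "pcircle y a = pdisc z b" for y z a b
  proof -
    define U where "U = {x::real^3. x \<bullet> z > b * norm x}"
    have "open U" unfolding U_def
      by (intro open_Collect_less continuous_intros)
    moreover have "z \<in> U" using z b by (simp add: U_def dot_square_norm)
    ultimately obtain e where e: "e > 0" "ball z e \<subseteq> U"
      by (meson open_contains_ball)
    define t where "t = e / 2"
    have t: "t > 0" using e by (simp add: t_def)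
    \<comment> \<open>This is the circle equation made homogeneous, so it holds on the whole open
      cone and not only on unit vectors.\<close>
    have *: "(x \<bullet> y)\<^sup>2 = a\<^sup>2 * (x \<bullet> x)" if "x \<in> U" for x
    proof -
      have "x \<noteq> 0" using that by (auto simp: U_def)
      then have "ppt (sgn x) \<in> pcircle y a"
        using that ppt_sgn_in_pdisc eq by (auto simp: U_def)
      then have "(sgn x \<bullet> y)\<^sup>2 = a\<^sup>2"
        by (auto simp: ppt_in_pcircle_iff)
      then show ?thesis using \<open>x \<noteq> 0\<close>
        by (simp add: sgn_div_norm dot_square_norm field_simps power_mult_distrib power_divide)
    qed
    have inner: "y \<bullet> y = 1" "z \<bullet> z = 1" using y z by (simp_all add: norm_eq_1)
    have quad: "(z \<bullet> y + i)\<^sup>2 = a\<^sup>2 * (1 + 2 * i * (z \<bullet> y) + i\<^sup>2)" if "\<bar>i\<bar> < e" for i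
    proof -
      have "z + i *\<^sub>R y \<in> U"
        using that y by (auto intro!: subsetD[OF e(2)] simp: dist_norm)
      from * [OF this] show ?thesis
        by (simp add: inner inner_simps inner_commute power2_eq_square algebra_simps)
    qed
    \<comment> \<open>Second difference along the segment from \<open>z - t y\<close> to
      \<open>z + t y\<close>: adding the last two equations and subtracting the first twice isolates
      the quadratic terms.\<close>
    have "(z \<bullet> y)\<^sup>2 = a\<^sup>2" "(z \<bullet> y + t)\<^sup>2 = a\<^sup>2 * (1 + 2 * t * (z \<bullet> y) + t\<^sup>2)"
      "(z \<bullet> y - t)\<^sup>2 = a\<^sup>2 * (1 - 2 * t * (z \<bullet> y) + t\<^sup>2)"
      using quad[of 0] quad[of t] quad[of "- t"] e(1) by (simp_all add: t_def)
    then have "t\<^sup>2 = a\<^sup>2 * t\<^sup>2" by algebra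
    then have "a\<^sup>2 = 1" using t by simp
    then show False using a by (simp add: power2_eq_1_iff)
  qed
  then show ?thesis by (fastforce simp: pcircles_def pdiscs_def)
qed

text \<open>Used in two ways: for the uniqueness of the line through two points, and for the
  direction of the affine line in which two planes meet.\<close>

lemma orthogonal_both_unique:
  fixes x x' y y' :: "real^3"
  assumes n: "norm x = 1" "norm x' = 1" "norm y = 1" "norm y' = 1"
    and ne: "ppt x \<noteq> ppt x'"
    and o: "x \<bullet> y = 0" "x' \<bullet> y = 0" "x \<bullet> y' = 0" "x' \<bullet> y' = 0"
  shows "ppt y = ppt y'"
proof (rule ccontr)
  assume ny: "ppt y \<noteq> ppt y'"
  have indep: "independent {u, v}" if "norm u = 1" "norm v = 1" "ppt u \<noteq> ppt v" for u v :: "real^3"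
  proof -
    have "u \<notin> span {v}"
    proof
      assume "u \<in> span {v}"
      then obtain k where k: "u = k *\<^sub>R v" by (auto simp: span_singleton)
      with that have "\<bar>k\<bar> = 1" by simp
      with k that show False by (auto simp: ppt_eq_iff abs_if split: if_splits)
    qed
    moreover have "v \<noteq> 0" using that by auto
    ultimately show ?thesis
      by (simp add: independent_insert)
  qed
  have d: "dim {x, x'} = 2" "dim {y, y'} = 2"
    using indep[OF n(1,2) ne] indep[OF n(3,4) ny] ne ny
    by (auto simp: dim_eq_card_independent card_insert_if)
  \<comment> \<open>Otherwise there would be two orthogonal planes in three-dimensional space.\<close>
  have "dim (span {x, x'} \<union> span {y, y'}) = dim (span {x, x'}) + dim (span {y, y'})"
  proof -
    have o': "orthogonal u v" if "u \<in> {x, x'}" "v \<in> {y, y'}" for u v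
      using that o by (auto simp: orthogonal_def)
    have "orthogonal u v" if "u \<in> span {x, x'}" "v \<in> span {y, y'}" for u v
      using orthogonal_to_span[OF that(2), of u]
        orthogonal_to_span[OF that(1)] o' by (metis orthogonal_commute)
    then show ?thesis
      by (intro dim_orthogonal_sum) (auto simp: orthogonal_def)
  qed
  moreover have "dim (span {x, x'} \<union> span {y, y'}) \<le> DIM(real^3)"
    by (rule dim_subset_UNIV)
  ultimately show False using d by simp
qed


text \<open>If \<open>y\<close> and \<open>z\<close> are not parallel, the planes
  \<open>x \<bullet> z = 0\<close> and \<open>x \<bullet> y = a\<close> meet in an affine line,
  which meets the sphere at most twice. If they are parallel, the intersection is empty because
  \<open>a\<close> is positive.\<close>

lemma finite_pline_Int_pcircle:
  assumes z: "norm z = 1" and y: "norm y = 1" and a: "0 < a"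
  shows "finite (pline z \<inter> pcircle y a)"
proof (cases "ppt y = ppt z")
  case True
  have False if p: "p \<in> pline z" "p \<in> pcircle y a" for p
  proof -
    obtain x where "p = ppt x"
      using p(1) pline_subset by (blast elim: ppointsE)
    then have "x \<bullet> z = 0" "x \<bullet> y = a \<or> x \<bullet> y = - a"
      using p by (simp_all add: ppt_in_pline_iff ppt_in_pcircle_iff)
    moreover have "y = z \<or> y = - z" using True by (simp add: ppt_eq_iff)
    ultimately show False using a by auto
  qed
  then have "pline z \<inter> pcircle y a = {}" by blast
  then show ?thesis by simp
next
  case False
  obtain n where n: "norm n = 1" "n \<bullet> y = 0" "n \<bullet> z = 0"
    by (rule unit_vector_orthogonal_both)
  \<comment> \<open>Each projective point of the circle has a representative with the positive sign,
    so \<open>X\<close> covers the intersection.\<close>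
  define X where "X = {x. norm x = 1 \<and> x \<bullet> z = 0 \<and> x \<bullet> y = a}"
  \<comment> \<open>The second candidate is the mirror image of \<open>x1\<close> in the plane
    orthogonal to \<open>n\<close>.\<close>
  have sub: "X \<subseteq> {x1, x1 - (2 * (x1 \<bullet> n)) *\<^sub>R n}" if x1: "x1 \<in> X" for x1
  proof
    fix x assume x: "x \<in> X"
    show "x \<in> {x1, x1 - (2 * (x1 \<bullet> n)) *\<^sub>R n}"
    proof (cases "x = x1")
      case ne: False
      have "ppt (sgn (x - x1)) = ppt n"
        by (rule orthogonal_both_unique[OF y z _ n(1) False])
          (use x x1 ne n in \<open>auto simp: norm_sgn X_def sgn_div_norm inner_simps inner_commute\<close>)
      then obtain l where l: "sgn (x - x1) = l *\<^sub>R n"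
        by (metis ppt_eq_iff scaleR_minus1_left scaleR_one)
      define m where "m = norm (x - x1) * l"
      have "x - x1 = norm (x - x1) *\<^sub>R sgn (x - x1)"
        using ne by (simp add: sgn_div_norm)
      then have xm: "x = x1 + m *\<^sub>R n"
        by (simp add: l m_def algebra_simps)
      with ne have "m \<noteq> 0" by auto
      have "x \<bullet> x = 1" "x1 \<bullet> x1 = 1" "n \<bullet> n = 1"
        using x x1 n by (auto simp: X_def norm_eq_1)
      then have "m * (m + 2 * (x1 \<bullet> n)) = 0"
        by (simp add: xm inner_simps inner_commute algebra_simps)
      with \<open>m \<noteq> 0\<close> have "m = - (2 * (x1 \<bullet> n))" by simp
      then show ?thesis using xm by simp
    qed simp
  qed
  have "finite X"
  proof (cases "X = {}")
    case False
    then obtain x1 where "x1 \<in> X" by blast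
    then show ?thesis by (meson sub finite.emptyI finite.insertI finite_subset)
  qed simp
  moreover have "pline z \<inter> pcircle y a \<subseteq> ppt ` X"
  proof
    fix p assume p: "p \<in> pline z \<inter> pcircle y a"
    then obtain x where x: "p = ppt x" "norm x = 1"
      using pline_subset by (blast elim: ppointsE)
    then have "x \<in> X \<or> - x \<in> X"
      using p by (auto simp: X_def ppt_in_pline_iff ppt_in_pcircle_iff)
    then show "p \<in> ppt ` X"
      using x ppt_uminus by (metis image_eqI)
  qed
  ultimately show ?thesis by (rule finite_surj)
qed

lemma plines_eqI:
  assumes "l \<in> plines" "l' \<in> plines" "p \<in> l \<inter> l'" "q \<in> l \<inter> l'" "p \<noteq> q"
  shows "l = l'"
proof -
  obtain y y' where l: "l = pline y" "norm y = 1" "l' = pline y'" "norm y' = 1"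
    using assms by (auto simp: plines_def)
  obtain x x' where x: "p = ppt x" "norm x = 1" "q = ppt x'" "norm x' = 1"
    using assms plines_subset by (blast elim: ppointsE)
  have "ppt y = ppt y'"
    by (rule orthogonal_both_unique[of x x']) (use assms l x in \<open>auto simp: ppt_in_pline_iff\<close>)
  then show ?thesis
    using l by (auto simp: ppt_eq_iff pline_def)
qed

subsection \<open>Countable sets closed under straightedge steps\<close>

definition joined_lines :: "ppoint set \<Rightarrow> ppoint set set" where
  "joined_lines G = {l \<in> plines. \<exists>p\<in>G. \<exists>q\<in>G. p \<noteq> q \<and> p \<in> l \<and> q \<in> l}"

text \<open>Pairs of circles do not appear: along the construction \<open>k\<close> stays the only
  circle.\<close>

definition straightedge_closed :: "ppoint set \<Rightarrow> ppoint set \<Rightarrow> bool" where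
  "straightedge_closed k G \<longleftrightarrow>
     (\<forall>s\<in>joined_lines G. \<forall>t\<in>joined_lines G. s \<noteq> t \<longrightarrow> s \<inter> t \<subseteq> G) \<and>
     (\<forall>s\<in>joined_lines G. s \<inter> k \<subseteq> G)"

text \<open>Density is tested on open sets of the surrounding space through radial projection. This
  avoids a topology on the projective plane and pulls back easily along linear maps.\<close>

definition pdense :: "ppoint set \<Rightarrow> bool" where
  "pdense G \<longleftrightarrow> (\<forall>U. open U \<and> U \<noteq> {} \<longrightarrow> (\<exists>x\<in>U. x \<noteq> 0 \<and> ppt (sgn x) \<in> G))"

lemma countable_joined_lines:
  assumes "countable G"
  shows "countable (joined_lines G)"
proof -
  \<comment> \<open>On distinct points \<open>L\<close> names the joining line; its value on equal
    points is irrelevant, since only an inclusion into the image is claimed.\<close>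
  define L where "L = (\<lambda>(p, q). THE l. l \<in> plines \<and> p \<in> l \<and> q \<in> l)"
  have "joined_lines G \<subseteq> L ` (G \<times> G)"
  proof
    fix l assume "l \<in> joined_lines G"
    then obtain p q where pq: "p \<in> G" "q \<in> G" "p \<noteq> q" "p \<in> l" "q \<in> l" "l \<in> plines"
      by (auto simp: joined_lines_def)
    then have "L (p, q) = l"
      unfolding L_def prod.case by (metis (no_types, lifting) IntI plines_eqI the_equality)
    then show "l \<in> L ` (G \<times> G)" using pq by force
  qed
  then show ?thesis
    using assms by (meson countable_SIGMA countable_image countable_subset)
qed

definition straightedge_extension :: "ppoint set \<Rightarrow> ppoint set \<Rightarrow> ppoint set" where
  "straightedge_extension k G =
     G \<union> (\<Union>s\<in>joined_lines G. \<Union>t\<in>joined_lines G - {s}. s \<inter> t) \<union> (\<Union>s\<in>joined_lines G. s \<inter> k)"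

text \<open>Countably many lines are involved, two distinct lines share at most one point, and each
  line meets \<open>k\<close> in finitely many points.\<close>

lemma countable_straightedge_extension:
  assumes "k \<in> pcircles" "countable G"
  shows "countable (straightedge_extension k G)"
proof -
  have "countable (s \<inter> t)" if "s \<in> joined_lines G" "t \<in> joined_lines G - {s}" for s t
  proof (cases "s \<inter> t = {}")
    case False
    then obtain p where "p \<in> s \<inter> t" by blast
    then have "s \<inter> t \<subseteq> {p}"
      using that plines_eqI by (auto simp: joined_lines_def)
    then show ?thesis by (meson countable_empty countable_insert countable_subset)
  qed simp
  moreover have "countable (s \<inter> k)" if "s \<in> joined_lines G" for s
    using that assms(1) finite_pline_Int_pcircle
    by (auto simp: joined_lines_def plines_def pcircles_def intro!: countable_finite)
  ultimately show ?thesis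
    unfolding straightedge_extension_def using assms(2) countable_joined_lines[OF assms(2)]
    by (intro countable_Un countable_UN countable_Diff)
qed

text \<open>Iterating the extension and taking the union suffices, because each intersection
  involves only finitely many points of the union and so happens at a finite stage.\<close>

lemma countable_straightedge_closed_superset:
  assumes k: "k \<in> pcircles" and D: "countable D"
  obtains G where "countable G" "D \<subseteq> G" "straightedge_closed k G"
proof -
  define S where "S n = (straightedge_extension k ^^ n) D" for n
  define G where "G = (\<Union>n. S n)"
  have "countable (S n)" for n
    by (induction n) (simp_all add: S_def D k countable_straightedge_extension)
  then have "countable G" by (simp add: G_def)
  moreover have "D \<subseteq> G"
    using UN_upper[of 0 UNIV S] by (simp add: G_def S_def)
  moreover have "straightedge_closed k G"
  proof -
    have S_Suc: "S (Suc n) = straightedge_extension k (S n)" for n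
      by (simp add: S_def)
    have mono: "mono S"
      unfolding mono_iff_le_Suc by (auto simp: S_Suc straightedge_extension_def)
    \<comment> \<open>Stating this for all late stages lets two lines be placed in a common
      stage.\<close>
    have joined: "\<exists>N. \<forall>n\<ge>N. l \<in> joined_lines (S n)" if l: "l \<in> joined_lines G" for l
    proof -
      obtain p q i j where *: "p \<in> S i" "q \<in> S j" "p \<noteq> q" "p \<in> l" "q \<in> l" "l \<in> plines"
        using l by (auto simp: joined_lines_def G_def)
      have "p \<in> S n" "q \<in> S n" if "n \<ge> max i j" for n
        using * that monoD[OF mono, of i n] monoD[OF mono, of j n] by auto
      then show ?thesis
        using *(3-6) unfolding joined_lines_def by blast
    qed
    have "s \<inter> t \<subseteq> G" if st: "s \<in> joined_lines G" "t \<in> joined_lines G" "s \<noteq> t" for s t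
    proof -
      obtain N where "s \<in> joined_lines (S N)" "t \<in> joined_lines (S N)"
        using joined[OF st(1)] joined[OF st(2)] by (meson nle_le)
      then have "s \<inter> t \<subseteq> S (Suc N)"
        using st(3) by (auto simp: S_Suc straightedge_extension_def)
      then show ?thesis by (auto simp: G_def)
    qed
    moreover have "s \<inter> k \<subseteq> G" if s: "s \<in> joined_lines G" for s
    proof -
      obtain N where "s \<in> joined_lines (S N)"
        using joined[OF s] by blast
      then have "s \<inter> k \<subseteq> S (Suc N)"
        by (auto simp: S_Suc straightedge_extension_def)
      then show ?thesis by (auto simp: G_def)
    qed
    ultimately show ?thesis by (simp add: straightedge_closed_def)
  qed
  ultimately show ?thesis by (rule that)
qed

lemma countable_pdense_exists: "\<exists>D. countable D \<and> pdense D"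
proof -
  obtain X :: "(real^3) set" where X: "countable X" "\<And>U. open U \<Longrightarrow> U \<noteq> {} \<Longrightarrow> \<exists>x\<in>X. x \<in> U"
    using countable_dense_exists by metis
  have "\<exists>x\<in>U. x \<noteq> 0 \<and> ppt (sgn x) \<in> (\<lambda>x. ppt (sgn x)) ` X" if U: "open U" "U \<noteq> {}" for U
  proof -
    \<comment> \<open>The zero vector represents no projective point and must be removed without
      emptying the open set.\<close>
    have "U \<noteq> {0}" using U(1) not_open_singleton by metis
    then have "U - {0} \<noteq> {}" using U by blast
    moreover have "open (U - {0})" using U by blast
    ultimately show ?thesis using X(2)[of "U - {0}"] by blast
  qed
  then show ?thesis
    using X(1) by (intro exI[of _ "(\<lambda>x. ppt (sgn x)) ` X"]) (simp add: pdense_def)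
qed

lemma pdense_meets_pdisc:
  assumes "pdense G" "d \<in> pdiscs"
  obtains p where "p \<in> G" "p \<in> d"
proof -
  obtain y a where d: "d = pdisc y a" "norm y = 1" "a < 1"
    using assms(2) by (auto simp: pdiscs_def)
  define U where "U = {x::real^3. x \<bullet> y > a * norm x}"
  have "open U" unfolding U_def
    by (intro open_Collect_less continuous_intros)
  moreover have "y \<in> U" using d by (simp add: U_def dot_square_norm)
  ultimately obtain x where "x \<in> U" "x \<noteq> 0" "ppt (sgn x) \<in> G"
    using assms(1) by (auto simp: pdense_def)
  then show ?thesis
    using that ppt_sgn_in_pdisc d by (auto simp: U_def)
qed

subsection \<open>Projective transformations\<close>

text \<open>For invertible linear \<open>f\<close> this is the induced projective transformation;
  \<open>sgn\<close> brings the image back to the sphere.\<close>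

definition pmap :: "(real^3 \<Rightarrow> real^3) \<Rightarrow> ppoint \<Rightarrow> ppoint" where
  "pmap f p = (\<lambda>x. sgn (f x)) ` p"

lemma pmap_ppt: "linear f \<Longrightarrow> pmap f (ppt x) = ppt (sgn (f x))"
  by (simp add: pmap_def ppt_def linear_neg sgn_minus)

text \<open>The inner normalisation only rescales by a positive factor, which the outer one
  discards; hence induced maps compose like linear maps.\<close>

lemma sgn_linear_sgn:
  fixes f :: "'a::real_normed_vector \<Rightarrow> 'b::real_normed_vector"
  assumes "linear f"
  shows "sgn (f (sgn x)) = sgn (f x)"
  by (cases "x = 0") (simp_all add: sgn_div_norm[of x] linear_scale[OF assms] sgn_scaleR)

context
  fixes f g :: "real^3 \<Rightarrow> real^3"
  assumes linf: "linear f" and ling: "linear g"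
    and fg: "\<And>x. f (g x) = x" and gf: "\<And>x. g (f x) = x"
begin

lemma pmap_inverse:
  assumes "p \<in> ppoints"
  shows "pmap g (pmap f p) = p"
proof -
  obtain x where x: "p = ppt x" "norm x = 1"
    using assms by (rule ppointsE)
  then have "sgn x = x" by (simp add: sgn_div_norm)
  then show ?thesis
    using x by (simp add: pmap_ppt linf ling sgn_linear_sgn gf)
qed

text \<open>Poles of lines transform by the adjoint of the inverse map, since \<open>f x \<bullet>
  adjoint g y = g (f x) \<bullet> y = x \<bullet> y\<close>.\<close>

lemma plines_preimage_pmap:
  assumes "l \<in> plines"
  obtains l' where "l' \<in> plines" "l = {p \<in> ppoints. pmap f p \<in> l'}"
proof -
  obtain y where y: "l = pline y" "norm y = 1"
    using assms by (auto simp: plines_def)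
  have inner: "f x \<bullet> adjoint g y = x \<bullet> y" for x
    by (simp add: adjoint_works[OF ling] gf)
  have "f y \<bullet> adjoint g y = 1" using y by (simp add: inner norm_eq_1)
  then have nz: "adjoint g y \<noteq> 0" by auto
  have f_nz: "f x \<noteq> 0" if "norm x = 1" for x
    using gf[of x] that linear_0[OF ling] by fastforce
  have "pmap f (ppt x) \<in> pline (sgn (adjoint g y)) \<longleftrightarrow> x \<bullet> y = 0" if "norm x = 1" for x
    using f_nz[OF that] nz inner[of x]
    by (simp add: pmap_ppt[OF linf] ppt_in_pline_iff norm_sgn sgn_div_norm[of "f x"]
        sgn_div_norm[of "adjoint g y"])
  then have "p \<in> pline y \<longleftrightarrow> pmap f p \<in> pline (sgn (adjoint g y))" if "p \<in> ppoints" for p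
    using that by (elim ppointsE) (simp add: ppt_in_pline_iff)
  then have "l = {p \<in> ppoints. pmap f p \<in> pline (sgn (adjoint g y))}"
    unfolding y using pline_subset by blast
  moreover have "pline (sgn (adjoint g y)) \<in> plines"
    using nz by (auto simp: plines_def norm_sgn)
  ultimately show ?thesis using that by blast
qed

text \<open>Projective transformations are injective and respect lines, so joining lines and their
  intersections pull back; the circle only has to be mapped into itself.\<close>

lemma straightedge_closed_preimage_pmap:
  assumes closed: "straightedge_closed k G" and k: "k \<subseteq> ppoints" "pmap f ` k \<subseteq> k"
  shows "straightedge_closed k {p \<in> ppoints. pmap f p \<in> G}"
proof -
  let ?G = "{p \<in> ppoints. pmap f p \<in> G}"
  have *: "\<exists>l'\<in>joined_lines G. l = {p \<in> ppoints. pmap f p \<in> l'}" if "l \<in> joined_lines ?G" for l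
  proof -
    obtain p q where pq: "p \<in> ?G" "q \<in> ?G" "p \<noteq> q" "p \<in> l" "q \<in> l" "l \<in> plines"
      using \<open>l \<in> joined_lines ?G\<close> by (auto simp: joined_lines_def)
    obtain l' where l': "l' \<in> plines" "l = {p \<in> ppoints. pmap f p \<in> l'}"
      using plines_preimage_pmap pq(6) by blast
    have "pmap f p \<noteq> pmap f q"
      using pq pmap_inverse by (metis (no_types, lifting) mem_Collect_eq)
    then have "l' \<in> joined_lines G"
      using pq l' by (auto simp: joined_lines_def)
    with l' show ?thesis by blast
  qed
  have "s \<inter> t \<subseteq> ?G" if "s \<in> joined_lines ?G" "t \<in> joined_lines ?G" "s \<noteq> t" for s t
  proof -
    obtain s' t' where "s' \<in> joined_lines G" "t' \<in> joined_lines G"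
      and st: "s = {p \<in> ppoints. pmap f p \<in> s'}" "t = {p \<in> ppoints. pmap f p \<in> t'}"
      using * \<open>s \<in> joined_lines ?G\<close> \<open>t \<in> joined_lines ?G\<close> by meson
    moreover have "s' \<noteq> t'" using st \<open>s \<noteq> t\<close> by auto
    ultimately have "s' \<inter> t' \<subseteq> G" using closed by (simp add: straightedge_closed_def)
    then show ?thesis using st by auto
  qed
  moreover have "s \<inter> k \<subseteq> ?G" if s: "s \<in> joined_lines ?G" for s
  proof -
    obtain s' where s': "s' \<in> joined_lines G" "s = {p \<in> ppoints. pmap f p \<in> s'}"
      using *[OF s] by blast
    then have "s' \<inter> k \<subseteq> G" using closed by (simp add: straightedge_closed_def)
    then show ?thesis using s' k by auto
  qed
  ultimately show ?thesis by (simp add: straightedge_closed_def)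
qed

text \<open>An open set \<open>U\<close> is tested by applying density of \<open>G\<close> to the
  open set of all \<open>x\<close> with \<open>g x \<in> U\<close>.\<close>

lemma pdense_preimage_pmap:
  assumes "pdense G"
  shows "pdense {p \<in> ppoints. pmap f p \<in> G}"
  unfolding pdense_def
proof (intro allI impI, elim conjE)
  fix U :: "(real^3) set" assume U: "open U" "U \<noteq> {}"
  have "open (g -` U)"
    by (intro open_vimage U linear_continuous_on linear_linear[THEN iffD2] ling)
  moreover have "g -` U \<noteq> {}" using U(2) gf by (metis ex_in_conv vimageI)
  ultimately obtain x where x: "g x \<in> U" "x \<noteq> 0" "ppt (sgn x) \<in> G"
    using assms unfolding pdense_def by (metis vimageD)
  have "g x \<noteq> 0" using x(2) fg[of x] linear_0[OF linf] by metis
  moreover have "pmap f (ppt (sgn (g x))) = ppt (sgn x)"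
    by (simp add: pmap_ppt linf sgn_linear_sgn fg)
  ultimately show "\<exists>x\<in>U. x \<noteq> 0 \<and> ppt (sgn x) \<in> {p \<in> ppoints. pmap f p \<in> G}"
    using x by (intro bexI[of _ "g x"]) (auto simp: ppt_in_ppoints_iff norm_sgn)
qed

end


section \<open>Hyperbolic rotations preserving a circle\<close>

lemma cosh_sinh_mult: "cosh h * cosh h = 1 + sinh h * sinh (h::real)"
  using cosh_square_eq[of h] by (simp add: power2_eq_square)

text \<open>A Lorentz boost in the plane spanned by the orthonormal vectors \<open>y\<close> and \<open>z\<close>. With
  \<open>r = sqrt (1 - a\<^sup>2) / a\<close> it preserves the quadratic form
  \<open>(x \<bullet> y)\<^sup>2 - a\<^sup>2 * (x \<bullet> x)\<close>, whose null cone is the circle \<open>pcircle y a\<close>.\<close>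

definition boost :: "real \<Rightarrow> real^3 \<Rightarrow> real^3 \<Rightarrow> real \<Rightarrow> real^3 \<Rightarrow> real^3" where
  "boost r y z h x =
     x + (cosh h * (x \<bullet> y) + sinh h * (x \<bullet> z) / r - x \<bullet> y) *\<^sub>R y
       + (r * sinh h * (x \<bullet> y) + cosh h * (x \<bullet> z) - x \<bullet> z) *\<^sub>R z"

context
  fixes r :: real and y z :: "real^3"
  assumes r: "r \<noteq> 0" and y: "norm y = 1" and z: "norm z = 1" and yz: "y \<bullet> z = 0"
begin

lemma linear_boost: "linear (boost r y z h)"
  by (rule linearI) (simp_all add: boost_def inner_simps algebra_simps add_divide_distrib)

lemma boost_inner:
  "boost r y z h x \<bullet> y = cosh h * (x \<bullet> y) + sinh h * (x \<bullet> z) / r"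
  "boost r y z h x \<bullet> z = r * sinh h * (x \<bullet> y) + cosh h * (x \<bullet> z)"
  using y z yz by (simp_all add: boost_def inner_simps norm_eq_1 inner_commute)

text \<open>On the \<open>y\<close> and \<open>z\<close> coordinates the boost is a rescaled
  hyperbolic rotation, inverted by negating \<open>h\<close>; the component orthogonal to both is
  untouched.\<close>

lemma boost_uminus_boost: "boost r y z (- h) (boost r y z h x) = x"
proof -
  have "cosh h * (boost r y z h x \<bullet> y) - sinh h * (boost r y z h x \<bullet> z) / r
      = (cosh h * cosh h - sinh h * sinh h) * (x \<bullet> y)"
    using r by (simp add: boost_inner field_simps)
  also have "\<dots> = x \<bullet> y" by (simp add: cosh_sinh_mult)
  finally have 1: "cosh h * (boost r y z h x \<bullet> y) - sinh h * (boost r y z h x \<bullet> z) / r = x \<bullet> y" .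
  have "cosh h * (boost r y z h x \<bullet> z) - r * sinh h * (boost r y z h x \<bullet> y)
      = (cosh h * cosh h - sinh h * sinh h) * (x \<bullet> z)"
    using r by (simp add: boost_inner field_simps)
  also have "\<dots> = x \<bullet> z" by (simp add: cosh_sinh_mult)
  finally have 2: "cosh h * (boost r y z h x \<bullet> z) - r * sinh h * (boost r y z h x \<bullet> y) = x \<bullet> z" .
  have "boost r y z (- h) (boost r y z h x) = boost r y z h x
     + (x \<bullet> y - boost r y z h x \<bullet> y) *\<^sub>R y + (x \<bullet> z - boost r y z h x \<bullet> z) *\<^sub>R z"
    unfolding boost_def[of r y z "- h"] 1[symmetric] 2[symmetric] by simp
  also have "\<dots> = x"
    unfolding boost_inner by (simp add: boost_def algebra_simps)
  finally show ?thesis .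
qed

lemma boost_boost_uminus: "boost r y z h (boost r y z (- h) x) = x"
  using boost_uminus_boost[of "- h" x] by simp

lemma boost_inner_self:
  "boost r y z h x \<bullet> boost r y z h x =
     x \<bullet> x + (boost r y z h x \<bullet> y)\<^sup>2 - (x \<bullet> y)\<^sup>2 + (boost r y z h x \<bullet> z)\<^sup>2 - (x \<bullet> z)\<^sup>2"
proof -
  define u v where "u = boost r y z h x \<bullet> y" and "v = boost r y z h x \<bullet> z"
  have b: "boost r y z h x = x + (u - x \<bullet> y) *\<^sub>R y + (v - x \<bullet> z) *\<^sub>R z"
    unfolding u_def v_def boost_inner by (simp add: boost_def)
  have "boost r y z h x \<bullet> boost r y z h x = x \<bullet> x + u\<^sup>2 - (x \<bullet> y)\<^sup>2 + v\<^sup>2 - (x \<bullet> z)\<^sup>2"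
    unfolding b using y z yz
    by (simp add: inner_simps norm_eq_1 inner_commute power2_eq_square algebra_simps)
  then show ?thesis by (simp add: u_def v_def)
qed

text \<open>A hyperbolic rotation preserves \<open>r\<^sup>2 * (x \<bullet> y)\<^sup>2 - (x
  \<bullet> z)\<^sup>2\<close>. Under the condition on \<open>r\<close>, \<open>a\<^sup>2\<close>
  times this differs from the claimed form only by a multiple of the squared length orthogonal to
  \<open>y\<close> and \<open>z\<close>, which is fixed.\<close>

lemma boost_quadratic_form:
  assumes a: "a\<^sup>2 * r\<^sup>2 = 1 - a\<^sup>2"
  shows "(boost r y z h x \<bullet> y)\<^sup>2 - a\<^sup>2 * (boost r y z h x \<bullet> boost r y z h x)
       = (x \<bullet> y)\<^sup>2 - a\<^sup>2 * (x \<bullet> x)"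
proof -
  have "r\<^sup>2 * (boost r y z h x \<bullet> y)\<^sup>2 - (boost r y z h x \<bullet> z)\<^sup>2
      = (cosh h * cosh h - sinh h * sinh h) * (r\<^sup>2 * (x \<bullet> y)\<^sup>2 - (x \<bullet> z)\<^sup>2)"
    using r unfolding boost_inner by (simp add: field_simps power2_eq_square)
  also have "\<dots> = r\<^sup>2 * (x \<bullet> y)\<^sup>2 - (x \<bullet> z)\<^sup>2" by (simp add: cosh_sinh_mult)
  finally have "a\<^sup>2 * r\<^sup>2 * (boost r y z h x \<bullet> y)\<^sup>2 - a\<^sup>2 * (boost r y z h x \<bullet> z)\<^sup>2
      = a\<^sup>2 * r\<^sup>2 * (x \<bullet> y)\<^sup>2 - a\<^sup>2 * (x \<bullet> z)\<^sup>2"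
    by (metis (no_types, opaque_lifting) mult.assoc right_diff_distrib)
  then show ?thesis
    unfolding boost_inner_self a by (simp add: algebra_simps)
qed

lemma pmap_boost_pcircle:
  assumes a: "a\<^sup>2 * r\<^sup>2 = 1 - a\<^sup>2"
  shows "pmap (boost r y z h) ` pcircle y a \<subseteq> pcircle y a"
proof clarify
  fix p assume p: "p \<in> pcircle y a"
  then obtain x where x: "p = ppt x" "norm x = 1"
    using pcircle_subset by (blast elim: ppointsE)
  define b where "b = boost r y z h x"
  have "(x \<bullet> y)\<^sup>2 = a\<^sup>2" using p x by (auto simp: ppt_in_pcircle_iff)
  then have eq: "(b \<bullet> y)\<^sup>2 = a\<^sup>2 * (b \<bullet> b)"
    using boost_quadratic_form[OF a, of h x] x by (simp add: b_def norm_eq_1)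
  have "b \<noteq> 0"
    using boost_uminus_boost[of h x] linear_0[OF linear_boost] x by (auto simp: b_def)
  then have "(sgn b \<bullet> y)\<^sup>2 = a\<^sup>2"
    using eq by (simp add: sgn_div_norm dot_square_norm power_divide power_mult_distrib field_simps)
  then have "sgn b \<bullet> y = a \<or> sgn b \<bullet> y = - a"
    by (simp add: power2_eq_iff)
  then show "pmap (boost r y z h) p \<in> pcircle y a"
    using \<open>b \<noteq> 0\<close> x
    by (simp add: pmap_ppt linear_boost ppt_in_pcircle_iff norm_sgn flip: b_def)
qed

text \<open>The quotient of the \<open>z\<close> and \<open>y\<close> coordinates is independent of
  scale and sign, hence a function of the projective point. It equals \<open>r * tanh h\<close>, and
  \<open>tanh\<close> is injective.\<close>

lemma inj_pmap_boost_center: "inj (\<lambda>h. pmap (boost r y z h) (ppt y))"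
proof (rule injI)
  fix h h' assume eq: "pmap (boost r y z h) (ppt y) = pmap (boost r y z h') (ppt y)"
  have b: "boost r y z i y \<bullet> y = cosh i" "boost r y z i y \<bullet> z = r * sinh i" for i
    using y yz by (simp_all add: boost_inner norm_eq_1)
  have nz: "boost r y z i y \<noteq> 0" for i
    using b(1)[of i] by (metis cosh_real_pos inner_zero_left less_irrefl)
  have t: "sgn (boost r y z i y) \<bullet> z / (sgn (boost r y z i y) \<bullet> y) = r * tanh i" for i
    using nz[of i] by (simp add: sgn_div_norm b tanh_def)
  from eq have "sgn (boost r y z h y) = sgn (boost r y z h' y)
      \<or> sgn (boost r y z h y) = - sgn (boost r y z h' y)"
    by (simp add: pmap_ppt linear_boost ppt_eq_iff)
  then have "r * tanh h = r * tanh h'"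
    unfolding t[symmetric] by auto
  then show "h = h'" using r by simp
qed

end

lemma straightedge_closed_pdense_avoiding_center:
  assumes "is_pcenter c k"
  obtains G where "straightedge_closed k G" "pdense G" "c \<notin> G"
proof -
  obtain y a where y: "norm y = 1" and a: "0 < a" "a < 1" and k: "k = pcircle y a" and c: "c = ppt y"
    using assms by (auto simp: is_pcenter_def)
  obtain z where z: "norm z = 1" "z \<bullet> y = 0"
    by (rule unit_vector_orthogonal_both)
  define r where "r = sqrt (1 - a\<^sup>2) / a"
  have a2: "a\<^sup>2 < 1" using a by (simp add: power_less_one_iff abs_square_less_1)
  then have r: "r \<noteq> 0" "a\<^sup>2 * r\<^sup>2 = 1 - a\<^sup>2"
    using a by (auto simp: r_def power_divide)
  note ctx = r(1) y z(1) z(2)[unfolded inner_commute[of z]]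
  have kc: "k \<in> pcircles" using y a k by (auto simp: pcircles_def)
  obtain D where D: "countable D" "pdense D"
    using countable_pdense_exists by blast
  obtain G where G: "countable G" "D \<subseteq> G" "straightedge_closed k G"
    using countable_straightedge_closed_superset[OF kc D(1)] by blast
  have "pdense G" using D(2) G(2) by (fastforce simp: pdense_def)
  \<comment> \<open>The positions of the moved center are in bijection with the reals, too many for
    the countable \<open>G\<close>.\<close>
  have "\<not> range (\<lambda>h. pmap (boost r y z h) (ppt y)) \<subseteq> G"
    using G(1) uncountable_UNIV_real countable_image_inj_on[OF _ inj_pmap_boost_center[OF ctx]]
    by (meson countable_subset)
  then obtain h where h: "pmap (boost r y z h) c \<notin> G" using c by auto
  have lin: "linear (boost r y z i)" for i
    using linear_boost[OF ctx] .
  note inv = boost_boost_uminus[OF ctx] boost_uminus_boost[OF ctx]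
  show ?thesis
  proof (rule that)
    show "straightedge_closed k {p \<in> ppoints. pmap (boost r y z h) p \<in> G}"
      using straightedge_closed_preimage_pmap[OF lin lin inv G(3)]
        pmap_boost_pcircle[OF ctx r(2)] pcircle_subset k by simp
    show "pdense {p \<in> ppoints. pmap (boost r y z h) p \<in> G}"
      by (rule pdense_preimage_pmap[OF lin lin inv \<open>pdense G\<close>])
    show "c \<notin> {p \<in> ppoints. pmap (boost r y z h) p \<in> G}"
      using h by simp
  qed
qed

subsection \<open>Branches of rooted trees\<close>

text \<open>Such an edge would close a walk from the root to itself, besides the one-vertex walk,
  against uniqueness.\<close>

lemma no_edge_into_root:
  assumes T: "rooted_tree r V E"
  shows "(u, r) \<notin> E"
proof
  assume e: "(u, r) \<in> E"
  then have "u \<in> V" using T by (auto simp: rooted_tree_def)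
  then obtain xs where xs: "is_walk V E (Finite_walk xs)" "hd xs = r" "last xs = u"
    using T by (auto simp: rooted_tree_def)
  have r: "r \<in> V" using T by (simp add: rooted_tree_def)
  have "is_walk V E (Finite_walk (xs @ [r]))" "hd (xs @ [r]) = r" "last (xs @ [r]) = r"
    using xs e r by (auto simp: successively_append_iff)
  moreover have "is_walk V E (Finite_walk [r])" "hd [r] = r" "last [r] = r"
    using r by auto
  ultimately have "xs @ [r] = [r]"
    using T r unfolding rooted_tree_def by metis
  then show False using xs by simp
qed

text \<open>Extension to the left would need an edge into the root, and extension to the right a
  child of the leaf.\<close>

lemma finite_walk_to_leaf_is_branch:
  assumes T: "rooted_tree r V E" and w: "is_walk V E (Finite_walk xs)" "hd xs = r"
    and leaf: "children E (last xs) = {}"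
  shows "is_branch V E (Finite_walk xs)"
  unfolding is_branch_def
proof (intro conjI allI impI)
  have xs: "xs \<noteq> []" using w by simp
  fix B assume "is_walk V E B \<and> walk_segment (Finite_walk xs) B"
  then have B: "is_walk V E B" "walk_segment (Finite_walk xs) B" by blast+
  show "B = Finite_walk xs"
  proof (cases B)
    case (Finite_walk ys)
    then obtain as bs where ys: "ys = as @ xs @ bs"
      using B by (auto simp: sublist_def)
    have "as = []"
    proof (rule ccontr)
      assume "as \<noteq> []"
      then have "(last as, hd xs) \<in> E"
        using B Finite_walk ys xs by (auto simp: successively_append_iff)
      then show False using no_edge_into_root[OF T] w by simp
    qed
    moreover have "bs = []"
    proof (rule ccontr)
      assume "bs \<noteq> []"
      then have "(last xs, hd bs) \<in> E"
        using B Finite_walk ys xs by (auto simp: successively_append_iff)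
      then show False using leaf by (auto simp: children_def)
    qed
    ultimately show ?thesis using Finite_walk ys by simp
  next
    case (Infinite_walk g)
    then obtain n where n: "\<forall>i<length xs. xs ! i = g (n + i)"
      using B by auto
    then have "last xs = g (n + (length xs - 1))"
      using xs by (simp add: last_conv_nth)
    then have "(last xs, g (Suc (n + (length xs - 1)))) \<in> E"
      using B Infinite_walk by simp
    then show ?thesis using leaf by (auto simp: children_def)
  qed
qed (rule w)

lemma infinite_walk_from_root_is_branch:
  assumes T: "rooted_tree r V E" and w: "is_walk V E (Infinite_walk f)" "f 0 = r"
  shows "is_branch V E (Infinite_walk f)"
  unfolding is_branch_def
proof (intro conjI allI impI)
  fix B assume "is_walk V E B \<and> walk_segment (Infinite_walk f) B"
  then have B: "is_walk V E B" "walk_segment (Infinite_walk f) B" by blast+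
  then obtain g n where g: "B = Infinite_walk g" "\<And>i. f i = g (n + i)"
    by (cases B) auto
  have "n = 0"
  proof (rule ccontr)
    assume "n \<noteq> 0"
    then obtain m where m: "n = Suc m" using not0_implies_Suc by blast
    have "(g m, g (Suc m)) \<in> E" using B g by simp
    moreover have "g (Suc m) = r" using g(2)[of 0] w m by simp
    ultimately show False using no_edge_into_root[OF T] by metis
  qed
  then show "B = Infinite_walk f" using g by auto
qed (rule w)

text \<open>Always moving on to a child that satisfies \<open>P\<close> either reaches a leaf or
  goes on forever; both outcomes give a branch.\<close>

lemma branch_with_invariant:
  assumes T: "rooted_tree r V E" and base: "P r"
    and step: "\<And>u. u \<in> V \<Longrightarrow> P u \<Longrightarrow> children E u \<noteq> {} \<Longrightarrow> \<exists>v\<in>children E u. P v"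
  obtains B where "is_branch V E B" "\<And>u. u \<in> walk_verts B \<Longrightarrow> P u"
proof -
  \<comment> \<open>At a leaf the value is arbitrary; \<open>f\<close> is trusted only up to the
    first leaf.\<close>
  define nxt where "nxt u = (SOME v. v \<in> children E u \<and> P v)" for u
  define f where "f n = (nxt ^^ n) r" for n
  have E: "E \<subseteq> V \<times> V" and r: "r \<in> V" using T by (auto simp: rooted_tree_def)
  have nxt: "nxt u \<in> children E u \<and> P (nxt u)" if "u \<in> V" "P u" "children E u \<noteq> {}" for u
    unfolding nxt_def by (rule someI_ex) (use step[OF that] in blast)
  have f0: "f 0 = r" and fSuc: "f (Suc n) = nxt (f n)" for n
    by (simp_all add: f_def)
  have inv: "f n \<in> V \<and> P (f n)" if "\<forall>i<n. children E (f i) \<noteq> {}" for n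
    using that
  proof (induction n)
    case (Suc n)
    then have "nxt (f n) \<in> children E (f n) \<and> P (nxt (f n))" by (intro nxt) auto
    then show ?case using E by (auto simp: fSuc children_def)
  qed (simp add: f0 r base)
  have edge: "(f n, f (Suc n)) \<in> E" if "\<forall>i\<le>n. children E (f i) \<noteq> {}" for n
    using nxt[of "f n"] inv[of n] that by (auto simp: fSuc children_def)
  show ?thesis
  proof (cases "\<forall>i. children E (f i) \<noteq> {}")
    case True
    show ?thesis
    proof (rule that)
      show "is_branch V E (Infinite_walk f)"
      proof (rule infinite_walk_from_root_is_branch[OF T])
        show "f 0 = r" by (rule f0)
        show "is_walk V E (Infinite_walk f)"
          using inv edge True by (simp add: image_subset_iff)
      qed
      show "P u" if "u \<in> walk_verts (Infinite_walk f)" for u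
        using that inv True by (simp add: image_iff) blast
    qed
  next
    case False
    define N where "N = (LEAST i. children E (f i) = {})"
    have N: "children E (f N) = {}"
      using False LeastI_ex[of "\<lambda>i. children E (f i) = {}"] unfolding N_def by simp
    have less: "children E (f i) \<noteq> {}" if "i < N" for i
      using not_less_Least[OF that[unfolded N_def]] by simp
    \<comment> \<open>The upper bound is \<open>Suc N\<close> because the leaf \<open>f N\<close>
      belongs to the branch.\<close>
    let ?xs = "map f [0..<Suc N]"
    have ok: "f i \<in> V \<and> P (f i)" if "i \<le> N" for i
      using inv[of i] less that by auto
    show ?thesis
    proof (rule that)
      show "is_branch V E (Finite_walk ?xs)"
      proof (rule finite_walk_to_leaf_is_branch[OF T])
        have "successively (\<lambda>u v. (u, v) \<in> E) ?xs"
          unfolding successively_conv_nth using edge less by (auto simp del: upt_Suc)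
        then show "is_walk V E (Finite_walk ?xs)"
          using ok by (auto simp del: upt_Suc)
        show "hd ?xs = r" using f0 by (simp add: hd_map del: upt_Suc)
        show "children E (last ?xs) = {}" using N by simp
      qed
    qed (use ok in \<open>auto simp del: upt_Suc\<close>)
  qed
qed

lemma finite_branch_ends_in_leaf:
  assumes T: "rooted_tree r V E" and B: "is_branch V E (Finite_walk xs)"
  shows "last xs \<in> set xs" "last xs \<in> V" "children E (last xs) = {}"
proof -
  have w: "xs \<noteq> []" "set xs \<subseteq> V" "successively (\<lambda>u v. (u, v) \<in> E) xs"
    using B by (auto simp: is_branch_def)
  then show "last xs \<in> set xs" "last xs \<in> V" by auto
  show "children E (last xs) = {}"
  proof (rule ccontr)
    assume "children E (last xs) \<noteq> {}"
    then obtain v where v: "(last xs, v) \<in> E" by (auto simp: children_def)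
    then have "v \<in> V" using T by (auto simp: rooted_tree_def)
    then have "is_walk V E (Finite_walk (xs @ [v]))"
      using w v by (auto simp: successively_append_iff)
    moreover have "walk_segment (Finite_walk xs) (Finite_walk (xs @ [v]))" by simp
    ultimately have "Finite_walk (xs @ [v]) = Finite_walk xs"
      using B unfolding is_branch_def by blast
    then show False by simp
  qed
qed

subsection \<open>The avoiding branch\<close>

text \<open>The invariant along the avoiding branch. Discs are unrestricted, being neither lines nor
  circles.\<close>

definition letters_within :: "ppoint set \<Rightarrow> ppoint set \<Rightarrow> letter list \<Rightarrow> bool" where
  "letters_within k G u \<longleftrightarrow>
     (\<forall>p. Pt p \<in> set u \<longrightarrow> p \<in> G) \<and>
     (\<forall>s. Fig s \<in> set u \<longrightarrow> (s \<in> plines \<longrightarrow> s \<in> joined_lines G) \<and> (s \<in> pcircles \<longrightarrow> s = k))"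

lemma straightedge_step_letters_within:
  assumes G: "straightedge_closed k G" "pdense G"
    and u: "letters_within k G u" and step: "straightedge_step u C" and ne: "C \<noteq> {}"
  shows "\<exists>v\<in>C. letters_within k G v"
proof -
  have pt: "letters_within k G (u @ [Pt p])" if "p \<in> G" for p
    using u that by (auto simp: letters_within_def)
  consider (line) l where "joining_line u l" "C = {u @ [Fig l]}"
    | (repeat) p where "Pt p \<in> set u" "C = {u @ [Pt p]}"
    | (intersection) p where "intersection_point u p" "C = {u @ [Pt p]}"
    | (disc) d where "d \<in> pdiscs" "C = {u @ [Fig d]}"
    | (choice) d where "d \<in> pdiscs" "C = {u @ [Pt p] | p. p \<in> ppoints \<and> p \<in> d}"
    using step ne unfolding straightedge_step_def by (elim disjE conjE exE bexE) (erule (1) that | simp)+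
  then show ?thesis
  proof cases
    case line
    then have "l \<in> joined_lines G"
      using u unfolding joining_line_def joined_lines_def letters_within_def by blast
    moreover from this have "l \<notin> pcircles"
      using plines_pcircles_disjoint by (auto simp: joined_lines_def)
    ultimately show ?thesis using line u by (auto simp: letters_within_def)
  next
    case repeat
    then show ?thesis using pt u by (simp add: letters_within_def)
  next
    case intersection
    then obtain s t where st: "Fig s \<in> set u" "Fig t \<in> set u" "p \<in> s \<inter> t"
      "s \<in> plines \<and> t \<in> plines \<and> s \<noteq> t \<or> s \<in> pcircles \<and> t \<in> pcircles \<and> s \<noteq> t
       \<or> s \<in> plines \<and> t \<in> pcircles"
      unfolding intersection_point_def by blast
    have fig: "s' \<in> plines \<Longrightarrow> s' \<in> joined_lines G" "s' \<in> pcircles \<Longrightarrow> s' = k"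
      if "Fig s' \<in> set u" for s'
      using that u by (auto simp: letters_within_def)
    from st(4) have "p \<in> G"
    proof (elim disjE conjE)
      assume "s \<in> plines" "t \<in> plines" "s \<noteq> t"
      then show ?thesis
        using fig(1)[OF st(1)] fig(1)[OF st(2)] st(3) G(1) unfolding straightedge_closed_def by blast
    next
      \<comment> \<open>Impossible, since both circles equal \<open>k\<close>.\<close>
      assume "s \<in> pcircles" "t \<in> pcircles" "s \<noteq> t"
      then show ?thesis using fig(2)[OF st(1)] fig(2)[OF st(2)] by simp
    next
      assume "s \<in> plines" "t \<in> pcircles"
      then show ?thesis
        using fig(1)[OF st(1)] fig(2)[OF st(2)] st(3) G(1) unfolding straightedge_closed_def by blast
    qed
    then show ?thesis using pt intersection by simp
  next
    case disc
    then show ?thesis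
      using u plines_pdiscs_disjoint pcircles_pdiscs_disjoint by (auto simp: letters_within_def)
  next
    case choice
    \<comment> \<open>The only step with a real choice of child: density provides a point of
      \<open>G\<close> in the disc.\<close>
    then obtain p where p: "p \<in> G" "p \<in> d"
      using pdense_meets_pdisc[OF G(2)] by blast
    then have "p \<in> ppoints"
      using choice(1) pdisc_subset by (auto simp: pdiscs_def)
    then show ?thesis using choice(2) p pt by blast
  qed
qed

theorem theorem3p5:
  fixes k :: "ppoint set" and c :: ppoint
  assumes "k \<in> pcircles" and "is_pcenter c k"
  shows "(\<forall>V E. straightedge_EC [Fig k] V E \<longrightarrow>
            (\<exists>B. is_branch V E B \<and> (\<forall>u\<in>walk_verts B. Pt c \<notin> set u)))
         \<and> \<not> straightedge_constructs {[Pt c]} [Fig k]"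
proof -
  obtain G where G: "straightedge_closed k G" "pdense G" "c \<notin> G"
    using straightedge_closed_pdense_avoiding_center[OF assms(2)] by blast
  have branch: "\<exists>B. is_branch V E B \<and> (\<forall>u\<in>walk_verts B. Pt c \<notin> set u)"
    if EC: "straightedge_EC [Fig k] V E" for V E
  proof -
    have T: "rooted_tree [Fig k] V E"
      and steps: "\<And>u. u \<in> V \<Longrightarrow> straightedge_step u (children E u)"
      using EC by (auto simp: straightedge_EC_def)
    have base: "letters_within k G [Fig k]"
      using assms(1) plines_pcircles_disjoint by (auto simp: letters_within_def)
    obtain B where "is_branch V E B" "\<And>u. u \<in> walk_verts B \<Longrightarrow> letters_within k G u"
      using branch_with_invariant[where P = "letters_within k G", OF T base]
        straightedge_step_letters_within[OF G(1,2) _ steps] by blast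
    then show ?thesis using G(3) by (auto simp: letters_within_def)
  qed
  moreover have "\<not> straightedge_constructs {[Pt c]} [Fig k]"
  proof
    assume "straightedge_constructs {[Pt c]} [Fig k]"
    then obtain V E where EC: "straightedge_EC [Fig k] V E" and finite: "terminating V E"
      and leaves: "\<And>u. u \<in> V \<Longrightarrow> children E u = {} \<Longrightarrow> suffix [Pt c] u"
      by (auto simp: straightedge_constructs_def)
    obtain B where B: "is_branch V E B" "\<forall>u\<in>walk_verts B. Pt c \<notin> set u"
      using branch[OF EC] by blast
    then obtain xs where xs: "B = Finite_walk xs"
      using finite by (auto simp: terminating_def)
    have "rooted_tree [Fig k] V E" using EC by (simp add: straightedge_EC_def)
    note leaf = finite_branch_ends_in_leaf[OF this B(1)[unfolded xs]]
    \<comment> \<open>Termination makes the avoiding branch end in a leaf, whose final segment would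
      have to be the forbidden letter.\<close>
    have "Pt c \<in> set (last xs)"
      using set_mono_suffix[OF leaves[OF leaf(2,3)]] by simp
    then show False using B(2) leaf(1) xs by simp
  qed
  ultimately show ?thesis by blast
qed

end
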